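(* Let $k\ge2$ be an integer. There exist positive constants $c_k,C_k,K_k,\kappa_k,\theta_k$ depending only on $k$ such that the following holds. Let $\delta\in(0,1]$ and $X_1,\dots,X_k,L\in[1,\infty)$, and put $$M:=\left\lceil c_k\,\delta^{-1/(k-1)}\right\rceil,\qquad Q:=C_k\left(\frac{\prod_{i=1}^kX_i}{L}\right)^{1/(k-1)}.$$ Assume that $$K_k\,M\log(2M)\le Q\le\kappa_k\min_{1\le i\le k}X_i.$$ Then there exist sets of integers $A_i\subset[X_i,2X_i]$ ($1\le i\le k$) such that $$\#\Bigl\{(a_1,\dots,a_k)\in\prod_{i=1}^kA_i:\ \operatorname{lcm}(a_1,\dots,a_k)\le L\Bigr\}\ge\delta\prod_{i=1}^k|A_i|$$ and $$\prod_{i=1}^k|A_i|\ge\theta_k\,\delta^{-\frac{k}{k-1}}\,\frac{L^{\frac{k}{k-1}}}{\bigl(\prod_{i=1}^kX_i\bigr)^{1/(k-1)}}.$$ *)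

theory Defs
  imports Complex_Main "HOL-Library.FuncSet"
begin

end

theory Submission
  imports Defs "HOL-Analysis.Harmonic_Numbers"
begin

text \<open>
  Put \<open>A\<^sub>i\<close> = the integers in \<open>[X\<^sub>i, 2X\<^sub>i]\<close> divisible by one of \<open>M\<close> consecutive moduli \<open>q\<close> of
  size about \<open>Q\<close>. If a single \<open>q\<close> divides all entries of a tuple, then its lcm is at most
  \<open>2^k \<Prod>X\<^sub>i / q^(k-1) \<le> L\<close>, and about a proportion \<open>M^(1-k)\<close> of all tuples is of this kind,
  provided that the sets of multiples hardly overlap. For two moduli \<open>p \<noteq> q\<close> the overlap is
  \<open>O(X gcd(p,q) / Q\<^sup>2)\<close>, and the gcds of pairs of distinct integers from an interval of length \<open>M\<close>
  add up to \<open>O(M\<^sup>2 log(2M))\<close>; so the hypothesis \<open>Q \<ge> K M log(2M)\<close> is what makes the total overlap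
  small, and no primes are needed.
\<close>

section \<open>Multiples of an integer in a real interval\<close>

lemma multiples_eq_image:
  fixes x y :: real and d :: int
  assumes "d > 0"
  shows "{a::int. x \<le> a \<and> a \<le> y \<and> d dvd a} = (\<lambda>t. d * t) ` {\<lceil>x / d\<rceil>..\<lfloor>y / d\<rfloor>}"
proof -
  have "x \<le> d * t \<longleftrightarrow> \<lceil>x / d\<rceil> \<le> t" "d * t \<le> y \<longleftrightarrow> t \<le> \<lfloor>y / d\<rfloor>" for t :: int
    using assms by (auto simp: ceiling_le_iff le_floor_iff field_simps)
  then show ?thesis by (auto elim!: dvdE)
qed

text \<open>When no quotient fits between the rounded endpoints, \<open>nat\<close> gives
  \<open>0\<close>, the size of the empty set.\<close>

lemma card_multiples:
  fixes x y :: real and d :: int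
  assumes "d > 0"
  shows "card {a::int. x \<le> a \<and> a \<le> y \<and> d dvd a} = nat (\<lfloor>y / d\<rfloor> - \<lceil>x / d\<rceil> + 1)"
  using assms by (simp add: multiples_eq_image card_image inj_on_def)

lemma card_multiples_ge:
  fixes x y :: real and d :: int
  assumes "d > 0"
  shows "(y - x) / d - 1 \<le> card {a::int. x \<le> a \<and> a \<le> y \<and> d dvd a}"
proof -
  have "(y - x) / d - 1 \<le> real_of_int (\<lfloor>y / d\<rfloor> - \<lceil>x / d\<rceil> + 1)"
    unfolding diff_divide_distrib by linarith
  then show ?thesis using card_multiples[OF assms, of x y] by linarith
qed

lemma card_multiples_le:
  fixes x y :: real and d :: int
  assumes "d > 0" "x \<le> y"
  shows "card {a::int. x \<le> a \<and> a \<le> y \<and> d dvd a} \<le> (y - x) / d + 1"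
proof -
  have "real_of_int (\<lfloor>y / d\<rfloor> - \<lceil>x / d\<rceil> + 1) \<le> (y - x) / d + 1"
    unfolding diff_divide_distrib by linarith
  moreover have "0 \<le> (y - x) / d" using assms by simp
  ultimately show ?thesis using card_multiples[OF assms(1), of x y] by linarith
qed

text \<open>Unlike in the preceding bound there is no additive \<open>1\<close>; such a term would ruin the estimate for
  pairwise overlaps, where the modulus may exceed \<open>y\<close>.\<close>

lemma card_positive_multiples_le:
  fixes x y :: real and d :: int
  assumes "d > 0" "0 < x" "x \<le> y"
  shows "card {a::int. x \<le> a \<and> a \<le> y \<and> d dvd a} \<le> y / d"
proof -
  \<comment> \<open>Positivity of \<open>x\<close> makes the ceiling of \<open>x / d\<close> at
    least \<open>1\<close>, which absorbs the \<open>+ 1\<close> of the exact count.\<close>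
  have "0 < x / d" "0 \<le> y / d" using assms by simp_all
  then have "real_of_int (\<lfloor>y / d\<rfloor> - \<lceil>x / d\<rceil> + 1) \<le> y / d"
    using zero_less_ceiling[of "x / d"] by linarith
  with \<open>0 \<le> y / d\<close> show ?thesis using card_multiples[OF assms(1), of x y] by linarith
qed

section \<open>Sums of gcds over consecutive integers\<close>

text \<open>The gcd divides the nonzero difference \<open>p - q\<close>, so it is one of the indices
  \<open>d\<close>, and its term alone suffices. In the sum the conditions on \<open>p\<close> and
  \<open>q\<close> are separate factors.\<close>

lemma gcd_le_sum_divisors:
  fixes p q :: int and m :: nat
  assumes "p \<noteq> q" "\<bar>p - q\<bar> \<le> m"
  shows "real_of_int (gcd p q) \<le> (\<Sum>d = 1..m. real d * of_bool (int d dvd p) * of_bool (int d dvd q))"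
proof -
  define g where "g = nat (gcd p q)"
  have "gcd p q > 0" using assms by auto
  moreover have "gcd p q \<le> \<bar>p - q\<bar>"
    using assms by (intro zdvd_imp_le) (auto simp: dvd_diff)
  ultimately have g_bounds: "0 < int g" "int g \<le> int m" and g_eq: "int g = gcd p q"
    using assms unfolding g_def by linarith+
  have dvds: "int g dvd p" "int g dvd q" unfolding g_eq by simp_all
  from g_bounds have g_in: "g \<in> {1..m}" by simp
  have "real_of_int (gcd p q) = real g * of_bool (int g dvd p) * of_bool (int g dvd q)"
    by (simp flip: g_eq add: dvds)
  also have "\<dots> \<le> (\<Sum>d = 1..m. real d * of_bool (int d dvd p) * of_bool (int d dvd q))"
    using g_in by (intro member_le_sum[where f = "\<lambda>d. real d * of_bool (int d dvd p) * of_bool (int d dvd q)"]) auto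
  finally show ?thesis .
qed

text \<open>After the sums are exchanged, \<open>d\<close> contributes \<open>d\<close> times the
  square of the number of its multiples in \<open>D\<close>. That number is at most
  \<open>2 * m / d\<close> because \<open>d\<close> is at most \<open>m\<close>, so the
  contributions form a harmonic sum.\<close>

lemma sum_gcd_consecutive_le:
  fixes N :: int and m :: nat
  assumes "m > 0"
  defines "D \<equiv> {N..<N + int m}"
  shows "(\<Sum>p\<in>D. \<Sum>q\<in>D - {p}. real_of_int (gcd p q)) \<le> 4 * real m ^ 2 * harm m"
proof -
  have count: "(\<Sum>p\<in>D. of_bool (int d dvd p)) \<le> 2 * real m / d" if d: "d \<in> {1..m}" for d
  proof -
    have "(\<Sum>p\<in>D. of_bool (int d dvd p)) = real (card {a::int. real_of_int N \<le> a \<and> a \<le> real_of_int (N + int m - 1) \<and> int d dvd a})"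
      unfolding D_def of_int_le_iff by (subst sum.mono_neutral_right[of _ "{a. N \<le> a \<and> a \<le> N + int m - 1 \<and> int d dvd a}"]) auto
    also have "\<dots> \<le> (real_of_int (N + int m - 1) - real_of_int N) / real_of_int (int d) + 1"
      using assms d by (intro card_multiples_le) auto
    also have "\<dots> = (real m - 1 + d) / d" using d by (simp add: field_simps)
    also have "\<dots> \<le> 2 * real m / d" using d by (intro divide_right_mono) auto
    finally show ?thesis .
  qed
  have "(\<Sum>p\<in>D. \<Sum>q\<in>D - {p}. real_of_int (gcd p q))
      \<le> (\<Sum>p\<in>D. \<Sum>q\<in>D - {p}. \<Sum>d = 1..m. real d * of_bool (int d dvd p) * of_bool (int d dvd q))"
    by (intro sum_mono gcd_le_sum_divisors) (auto simp: D_def)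
  \<comment> \<open>Adding the diagonal turns the double sum into a square. This is cheap only now
    that divisors are cut off at \<open>m\<close>: the gcd of \<open>p\<close> with itself would be
    of the size of \<open>p\<close>.\<close>
  also have "\<dots> \<le> (\<Sum>p\<in>D. \<Sum>q\<in>D. \<Sum>d = 1..m. real d * of_bool (int d dvd p) * of_bool (int d dvd q))"
    by (intro sum_mono sum_mono2) (auto simp: D_def intro!: sum_nonneg)
  also have "\<dots> = (\<Sum>p\<in>D. \<Sum>d = 1..m. \<Sum>q\<in>D. real d * of_bool (int d dvd p) * of_bool (int d dvd q))"
    by (intro sum.cong refl sum.swap)
  also have "\<dots> = (\<Sum>d = 1..m. \<Sum>p\<in>D. \<Sum>q\<in>D. real d * of_bool (int d dvd p) * of_bool (int d dvd q))"
    by (rule sum.swap)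
  also have "\<dots> = (\<Sum>d = 1..m. real d * (\<Sum>p\<in>D. of_bool (int d dvd p)) ^ 2)"
    unfolding power2_eq_square sum_product by (simp add: sum_distrib_left mult.assoc)
  also have "\<dots> \<le> (\<Sum>d = 1..m. real d * (2 * real m / d) ^ 2)"
    using count by (intro sum_mono mult_left_mono power_mono sum_nonneg) auto
  also have "\<dots> = (\<Sum>d = 1..m. 4 * real m ^ 2 * inverse (real d))"
    by (intro sum.cong refl) (auto simp: field_simps power2_eq_square)
  also have "\<dots> = 4 * real m ^ 2 * harm m"
    by (simp add: harm_def sum_distrib_left)
  finally show ?thesis .
qed

section \<open>Sets of multiples and their overlaps\<close>

definition multiples :: "real \<Rightarrow> int \<Rightarrow> int set" where
  "multiples x q = {a. x \<le> real_of_int a \<and> real_of_int a \<le> 2 * x \<and> q dvd a}"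

text \<open>For distinct \<open>q\<close> in \<open>D\<close> these sets are disjoint, so the size
  of their union is a plain sum.\<close>

definition private_multiples :: "real \<Rightarrow> int set \<Rightarrow> int \<Rightarrow> int set" where
  "private_multiples x D q = multiples x q - (\<Union>p\<in>D - {q}. multiples x p)"

lemma finite_multiples [simp]: "finite (multiples x q)"
proof (rule finite_subset)
  show "multiples x q \<subseteq> {\<lceil>x\<rceil>..\<lfloor>2 * x\<rfloor>}"
    by (auto simp: multiples_def ceiling_le_iff le_floor_iff)
qed simp

lemma card_private_multiples_ge:
  assumes "finite D"
  shows "card (multiples x q) - (\<Sum>p\<in>D - {q}. real (card (multiples x q \<inter> multiples x p)))
      \<le> card (private_multiples x D q)"
proof -
  have "private_multiples x D q = multiples x q - (\<Union>p\<in>D - {q}. multiples x q \<inter> multiples x p)"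
    by (auto simp: private_multiples_def)
  then have "real (card (multiples x q)) \<le> real (card (private_multiples x D q))
      + real (card (\<Union>p\<in>D - {q}. multiples x q \<inter> multiples x p))"
    using assms diff_card_le_card_Diff[of "\<Union>p\<in>D - {q}. multiples x q \<inter> multiples x p" "multiples x q"]
    by simp
  moreover have "real (card (\<Union>p\<in>D - {q}. multiples x q \<inter> multiples x p))
      \<le> (\<Sum>p\<in>D - {q}. real (card (multiples x q \<inter> multiples x p)))"
    unfolding of_nat_sum[symmetric] of_nat_le_iff using assms by (intro card_UN_le) auto
  ultimately show ?thesis by linarith
qed

text \<open>Common multiples of \<open>p\<close> and \<open>q\<close> are multiples of the lcm,
  which is \<open>p * q\<close> divided by the gcd and hence at least \<open>Q^2\<close> divided by
  the gcd.\<close>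

lemma card_multiples_Int_le:
  assumes "Q > 0" "Q \<le> p" "Q \<le> q" "x > 0"
  shows "card (multiples x p \<inter> multiples x q) \<le> 2 * x / Q ^ 2 * real_of_int (gcd p q)"
proof -
  have pos: "real_of_int p > 0" "real_of_int q > 0" using assms by linarith+
  then have pq: "p > 0" "q > 0" by auto
  then have l: "lcm p q > 0" by (simp add: lcm_pos_int)
  have "multiples x p \<inter> multiples x q = {a::int. x \<le> a \<and> a \<le> 2 * x \<and> lcm p q dvd a}"
    by (auto simp: multiples_def)
  then have "card (multiples x p \<inter> multiples x q) \<le> 2 * x / lcm p q"
    using card_positive_multiples_le[OF l, of x "2 * x"] assms by simp
  also have "\<dots> = 2 * x / (real_of_int p * real_of_int q) * real_of_int (gcd p q)"
  proof -
    have "real_of_int (gcd p q) * real_of_int (lcm p q) = real_of_int p * real_of_int q"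
      using prod_gcd_lcm_int[of p q] pq by (metis abs_of_pos of_int_mult)
    then show ?thesis using l pos by (simp add: field_simps)
  qed
  also have "\<dots> \<le> 2 * x / Q ^ 2 * real_of_int (gcd p q)"
    using assms pos by (intro mult_right_mono divide_left_mono) (auto simp: power2_eq_square intro!: mult_mono)
  finally show ?thesis .
qed

lemma consecutive_bounds:
  fixes N q :: int and m :: nat and Q :: real
  assumes "Q \<le> N" "real_of_int N + m \<le> 2 * Q + 1" "q \<in> {N..<N + int m}"
  shows "Q \<le> q" "q \<le> 2 * Q"
proof -
  have "real_of_int N \<le> real_of_int q" "real_of_int q \<le> real_of_int (N + int m - 1)"
    using assms(3) unfolding of_int_le_iff by auto
  then show "Q \<le> q" "q \<le> 2 * Q" using assms(1,2) by auto
qed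

text \<open>The assumption \<open>4 * Q \<le> x\<close> makes the rounding loss of \<open>1\<close>
  at most half of \<open>x / (2 * Q)\<close>.\<close>

lemma card_multiples_bounds:
  assumes "Q > 0" "Q \<le> real_of_int q" "real_of_int q \<le> 2 * Q" "4 * Q \<le> x"
  shows "x / (4 * Q) \<le> card (multiples x q)" "card (multiples x q) \<le> 2 * x / Q"
proof -
  have q: "real_of_int q > 0" "q > 0" using assms(1,2) by linarith+
  have x: "x > 0" using assms by linarith
  have "x / (4 * Q) \<le> x / (2 * Q) - 1" using assms by (simp add: field_simps)
  also have "x / (2 * Q) \<le> x / q" using assms q x by (intro divide_left_mono) auto
  finally show "x / (4 * Q) \<le> card (multiples x q)"
    using card_multiples_ge[OF q(2), where x = x and y = "2 * x"] by (simp add: multiples_def)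
  have "2 * x / q \<le> 2 * x / Q" using assms q x by (intro divide_left_mono) auto
  then show "card (multiples x q) \<le> 2 * x / Q"
    using card_positive_multiples_le[OF q(2), where x = x and y = "2 * x"] x by (simp add: multiples_def)
qed

lemma ln_double_ge:
  assumes "m > (0::nat)"
  shows "ln (real m) + 2 / 3 \<le> ln (2 * real m)" "2 / 3 \<le> ln (2 * real m)"
proof -
  have "ln (2 * real m) = ln 2 + ln (real m)" using assms by (simp add: ln_mult)
  moreover have "0 \<le> ln (real m)" using assms by simp
  ultimately show "ln (real m) + 2 / 3 \<le> ln (2 * real m)" "2 / 3 \<le> ln (2 * real m)"
    using ln2_ge_two_thirds by linarith+
qed

text \<open>The \<open>m\<close> sets of multiples have total size at least
  \<open>m * x / (4 * Q)\<close>. The factor \<open>128\<close> in the assumption on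
  \<open>Q\<close> is chosen so that the pairwise overlaps remove at most half of this.\<close>

lemma sum_card_private_multiples_ge:
  fixes N :: int and m :: nat and Q x :: real
  assumes m: "m > 0" and Q: "Q > 0" "128 * real m * ln (2 * real m) \<le> Q" and x: "4 * Q \<le> x"
    and N: "Q \<le> N" "real_of_int N + m \<le> 2 * Q + 1"
  defines "D \<equiv> {N..<N + int m}"
  shows "m * x / (8 * Q) \<le> (\<Sum>q\<in>D. real (card (private_multiples x D q)))"
proof -
  note D = consecutive_bounds[OF N, folded D_def]
  have xpos: "x > 0" using Q x by linarith
  have harm: "harm m \<le> 2 * ln (2 * real m)"
  proof -
    \<comment> \<open>The sequence \<open>harm m - ln m\<close> decreases and starts at
      \<open>1\<close>.\<close>
    have "harm m \<le> ln (real m) + 1" using euler_mascheroni_sequence_decreasing[of 1 m] m by (simp add: harm_def)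
    also have "\<dots> \<le> 2 * ln (2 * real m)"
      using ln_double_ge[OF m] by linarith
    finally show ?thesis .
  qed
  have "(\<Sum>q\<in>D. \<Sum>p\<in>D - {q}. real (card (multiples x q \<inter> multiples x p)))
      \<le> (\<Sum>q\<in>D. \<Sum>p\<in>D - {q}. 2 * x / Q ^ 2 * real_of_int (gcd q p))"
    using D Q xpos by (intro sum_mono card_multiples_Int_le) auto
  also have "\<dots> = 2 * x / Q ^ 2 * (\<Sum>q\<in>D. \<Sum>p\<in>D - {q}. real_of_int (gcd q p))"
    by (simp add: sum_distrib_left)
  also have "\<dots> \<le> 2 * x / Q ^ 2 * (4 * real m ^ 2 * harm m)"
    unfolding D_def using m xpos by (intro mult_left_mono sum_gcd_consecutive_le) auto
  also have "\<dots> \<le> 2 * x / Q ^ 2 * (4 * real m ^ 2 * (2 * ln (2 * real m)))"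
    using harm xpos by (intro mult_left_mono) auto
  also have "\<dots> = m * x / (8 * Q ^ 2) * (128 * m * ln (2 * m))"
    by (simp add: power2_eq_square)
  also have "\<dots> \<le> m * x / (8 * Q ^ 2) * Q"
    using Q xpos by (intro mult_left_mono) auto
  also have "\<dots> = m * x / (8 * Q)" using Q by (simp add: power2_eq_square)
  finally have overlap: "(\<Sum>q\<in>D. \<Sum>p\<in>D - {q}. real (card (multiples x q \<inter> multiples x p))) \<le> m * x / (8 * Q)" .
  have "m * (x / (4 * Q)) = (\<Sum>q\<in>D. x / (4 * Q))" by (simp add: D_def)
  also have "\<dots> \<le> (\<Sum>q\<in>D. real (card (multiples x q)))"
    using D Q x by (intro sum_mono card_multiples_bounds) auto
  finally have "m * x / (8 * Q) \<le> (\<Sum>q\<in>D. real (card (multiples x q)))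
      - (\<Sum>q\<in>D. \<Sum>p\<in>D - {q}. real (card (multiples x q \<inter> multiples x p)))"
    using overlap Q by (simp add: field_simps)
  also have "\<dots> \<le> (\<Sum>q\<in>D. real (card (private_multiples x D q)))"
    unfolding sum_subtractf[symmetric]
    by (intro sum_mono card_private_multiples_ge) (simp add: D_def)
  finally show ?thesis .
qed

section \<open>Tuples with a common modulus: lcm and number\<close>

text \<open>Multiplying the quotients \<open>a i div q\<close> together and then by a single
  \<open>q\<close> gives a common multiple. It falls short of the product of all \<open>a i\<close>
  by \<open>card I - 1\<close> factors \<open>q\<close>.\<close>

lemma Lcm_common_divisor_le:
  fixes a :: "'i \<Rightarrow> int" and q :: int and X :: "'i \<Rightarrow> real"
  assumes "finite I" "I \<noteq> {}" "q > 0"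
    and a: "\<And>i. i \<in> I \<Longrightarrow> a i > 0" "\<And>i. i \<in> I \<Longrightarrow> q dvd a i" "\<And>i. i \<in> I \<Longrightarrow> real_of_int (a i) \<le> X i"
  shows "real_of_int (Lcm (a ` I)) * real_of_int q ^ (card I - 1) \<le> (\<Prod>i\<in>I. X i)"
proof -
  define P where "P = q * (\<Prod>i\<in>I. a i div q)"
  have div: "a i div q > 0" if "i \<in> I" for i
    using a(1,2)[OF that] \<open>q > 0\<close> by (simp add: pos_imp_zdiv_pos_iff zdvd_imp_le)
  have "Lcm (a ` I) dvd P"
  proof (intro Lcm_least, clarify)
    fix i assume i: "i \<in> I"
    have "a i = q * (a i div q)" using a(2)[OF i] by simp
    also have "\<dots> dvd P" unfolding P_def using i assms(1) by (intro mult_dvd_mono dvd_prodI) auto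
    finally show "a i dvd P" .
  qed
  moreover have "P > 0" unfolding P_def using div \<open>q > 0\<close> by (intro mult_pos_pos prod_pos) auto
  ultimately have "Lcm (a ` I) \<le> P" by (rule zdvd_imp_le)
  then have "Lcm (a ` I) * q ^ (card I - 1) \<le> P * q ^ (card I - 1)"
    using \<open>q > 0\<close> by (intro mult_right_mono) auto
  also have "\<dots> = (\<Prod>i\<in>I. a i div q) * q ^ card I"
    using assms(1,2) by (cases "card I") (auto simp: P_def)
  also have "\<dots> = (\<Prod>i\<in>I. (a i div q) * q)" by (simp add: prod.distrib)
  also have "\<dots> = (\<Prod>i\<in>I. a i)" using a by (intro prod.cong) auto
  finally have "real_of_int (Lcm (a ` I) * q ^ (card I - 1)) \<le> real_of_int (\<Prod>i\<in>I. a i)"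
    by (simp only: of_int_le_iff)
  also have "\<dots> = (\<Prod>i\<in>I. real_of_int (a i))" by simp
  also have "\<dots> \<le> (\<Prod>i\<in>I. X i)"
    using a by (intro prod_mono) (auto intro: less_imp_le)
  finally show ?thesis by simp
qed


text \<open>Each modulus yields a box of tuples. The count grows only linearly in \<open>m\<close>,
  while the number of all tuples is of order \<open>m^k\<close> for \<open>k\<close> coordinates;
  this is the source of the proportion \<open>m^(1-k)\<close>.\<close>

lemma card_aligned_tuples_ge:
  fixes X :: "'i \<Rightarrow> real" and N :: int and m :: nat and Q :: real
  assumes m: "m > 0" and Q: "Q > 0" "128 * real m * ln (2 * real m) \<le> Q"
    and I: "finite I" "I \<noteq> {}" and X: "\<And>i. i \<in> I \<Longrightarrow> 4 * Q \<le> X i"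
    and N: "Q \<le> N" "real_of_int N + m \<le> 2 * Q + 1"
  defines "D \<equiv> {N..<N + int m}"
  shows "m * (\<Prod>i\<in>I. X i / (8 * Q))
    \<le> real (card {a \<in> PiE I (\<lambda>i. \<Union>q\<in>D. multiples (X i) q). \<exists>q\<in>D. \<forall>i\<in>I. q dvd a i})"
    (is "_ \<le> real (card ?G)")
proof -
  obtain j where j: "j \<in> I" using I by auto
  \<comment> \<open>Removing overlaps in the single coordinate \<open>j\<close> already makes the boxes disjoint.\<close>
  define B where "B q i = (if i = j then private_multiples (X i) D q else multiples (X i) q)" for q i
  have fin_B: "finite (B q i)" for q i by (simp add: B_def private_multiples_def)
  have B_sub: "B q i \<subseteq> multiples (X i) q" for q i by (auto simp: B_def private_multiples_def)
  note D = consecutive_bounds[OF N, folded D_def]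
  have Xpos: "X i > 0" if "i \<in> I" for i using X[OF that] Q by linarith
  have disj: "PiE I (B p) \<inter> PiE I (B q) = {}" if "p \<in> D" "q \<in> D" "p \<noteq> q" for p q
  proof -
    have "B p j \<inter> B q j = {}" using that by (auto simp: B_def private_multiples_def)
    then show ?thesis using j by (auto dest!: PiE_mem)
  qed
  have "m * (\<Prod>i\<in>I. X i / (8 * Q)) = m * X j / (8 * Q) * (\<Prod>i\<in>I - {j}. X i / (8 * Q))"
    using I j by (simp add: prod.remove)
  also have "\<dots> \<le> (\<Sum>q\<in>D. real (card (private_multiples (X j) D q))) * (\<Prod>i\<in>I - {j}. X i / (8 * Q))"
    unfolding D_def using m Q X j N Xpos
    by (intro mult_right_mono sum_card_private_multiples_ge prod_nonneg) (auto intro: less_imp_le)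
  also have "\<dots> = (\<Sum>q\<in>D. real (card (B q j)) * (\<Prod>i\<in>I - {j}. X i / (8 * Q)))"
    by (simp add: sum_distrib_right B_def)
  also have "\<dots> \<le> (\<Sum>q\<in>D. real (card (B q j)) * (\<Prod>i\<in>I - {j}. real (card (B q i))))"
  proof (intro sum_mono mult_left_mono prod_mono conjI)
    fix q i assume q: "q \<in> D" and i: "i \<in> I - {j}"
    \<comment> \<open>The weaker constant gives these coordinates the same factor as
      \<open>j\<close>, where half is lost to overlaps.\<close>
    have "X i / (8 * Q) \<le> X i / (4 * Q)" using Q Xpos i by (intro divide_left_mono) (auto intro: less_imp_le)
    also have "\<dots> \<le> card (multiples (X i) q)"
      using D[OF q] Q X i by (intro card_multiples_bounds) auto
    finally show "X i / (8 * Q) \<le> card (B q i)" using i by (simp add: B_def)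
    show "0 \<le> X i / (8 * Q)" using Q Xpos[of i] i by simp
  qed simp
  also have "\<dots> = (\<Sum>q\<in>D. real (card (PiE I (B q))))"
    using I j by (simp add: card_PiE prod.remove)
  also have "\<dots> = card (\<Union>q\<in>D. PiE I (B q))"
    using disj fin_B I by (subst card_UN_disjoint) (auto simp: D_def intro!: finite_PiE)
  also have "\<dots> \<le> card ?G"
  proof (intro of_nat_mono card_mono)
    show "finite ?G" using I by (intro finite_subset[of ?G, OF _ finite_PiE[of I "\<lambda>i. \<Union>q\<in>D. multiples (X i) q"]]) (auto simp: D_def)
    show "(\<Union>q\<in>D. PiE I (B q)) \<subseteq> ?G"
    proof (clarify, intro conjI)
      fix q a assume q: "q \<in> D" and a: "a \<in> PiE I (B q)"
      have ai: "a i \<in> multiples (X i) q" if "i \<in> I" for i using PiE_mem[OF a that] B_sub by auto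
      show "a \<in> PiE I (\<lambda>i. \<Union>q\<in>D. multiples (X i) q)"
        using a ai q by (auto simp: PiE_iff)
      show "\<exists>q\<in>D. \<forall>i\<in>I. q dvd a i" using ai q by (auto simp: multiples_def)
    qed
  qed
  finally show ?thesis .
qed

text \<open>Private multiples give the lower bound and the union bound the upper one. They differ by
  a factor \<open>16\<close>.\<close>

lemma card_UN_multiples_bounds:
  fixes N :: int and m :: nat and Q x :: real
  assumes m: "m > 0" and Q: "Q > 0" "128 * real m * ln (2 * real m) \<le> Q" and x: "4 * Q \<le> x"
    and N: "Q \<le> N" "real_of_int N + m \<le> 2 * Q + 1"
  defines "D \<equiv> {N..<N + int m}"
  shows "m * (x / (8 * Q)) \<le> card (\<Union>q\<in>D. multiples x q)"
    and "card (\<Union>q\<in>D. multiples x q) \<le> m * (2 * x / Q)"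
proof -
  note D = consecutive_bounds[OF N, folded D_def]
  have "m * (x / (8 * Q)) \<le> (\<Sum>q\<in>D. real (card (private_multiples x D q)))"
    using sum_card_private_multiples_ge[OF m Q x N] by (simp add: D_def)
  also have "\<dots> = card (\<Union>q\<in>D. private_multiples x D q)"
    by (subst card_UN_disjoint) (auto simp: D_def private_multiples_def)
  also have "\<dots> \<le> card (\<Union>q\<in>D. multiples x q)"
    by (intro of_nat_mono card_mono) (auto simp: D_def private_multiples_def)
  finally show "m * (x / (8 * Q)) \<le> card (\<Union>q\<in>D. multiples x q)" .
  have "card (\<Union>q\<in>D. multiples x q) \<le> (\<Sum>q\<in>D. card (multiples x q))"
    by (intro card_UN_le) (simp add: D_def)
  then have "real (card (\<Union>q\<in>D. multiples x q)) \<le> (\<Sum>q\<in>D. real (card (multiples x q)))"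
    by (metis of_nat_le_iff of_nat_sum)
  also have "\<dots> \<le> (\<Sum>q\<in>D. 2 * x / Q)" using D Q x by (intro sum_mono card_multiples_bounds) auto
  finally show "card (\<Union>q\<in>D. multiples x q) \<le> m * (2 * x / Q)" by (simp add: D_def)
qed

section \<open>Choice of constants and assembly\<close>

theorem proposition4p2:
  fixes k :: nat
  assumes "k \<ge> 2"
  shows "\<exists>c C K \<kappa> \<theta> :: real. c > 0 \<and> C > 0 \<and> K > 0 \<and> \<kappa> > 0 \<and> \<theta> > 0 \<and>
    (\<forall>(\<delta>::real) (X :: nat \<Rightarrow> real) (L::real).
      0 < \<delta> \<and> \<delta> \<le> 1 \<and> (\<forall>i\<in>{1..k}. 1 \<le> X i) \<and> 1 \<le> L \<longrightarrow>
      (let M = real_of_int \<lceil>c * \<delta> powr (- 1 / (real k - 1))\<rceil>;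
           Q = C * ((\<Prod>i=1..k. X i) / L) powr (1 / (real k - 1))
       in K * M * ln (2 * M) \<le> Q \<and> Q \<le> \<kappa> * Min (X ` {1..k}) \<longrightarrow>
          (\<exists>A :: nat \<Rightarrow> int set.
            (\<forall>i\<in>{1..k}. real_of_int ` A i \<subseteq> {X i..2 * X i}) \<and>
            real (card {a \<in> PiE {1..k} A. real_of_int (Lcm (a ` {1..k})) \<le> L})
              \<ge> \<delta> * (\<Prod>i=1..k. real (card (A i))) \<and>
            (\<Prod>i=1..k. real (card (A i)))
              \<ge> \<theta> * \<delta> powr (- real k / (real k - 1)) *
                (L powr (real k / (real k - 1)) /
                 (\<Prod>i=1..k. X i) powr (1 / (real k - 1))))))"
proof -
  \<comment> \<open>Per coordinate, \<open>1 / 512\<close> comes from the lower bound for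
    \<open>m\<close>, and \<open>32 = 8 * 4\<close> from the lower bound for
    \<open>card (A i)\<close> and the factor \<open>4\<close> in \<open>Q\<close>.\<close>
  define \<theta> :: real where "\<theta> = (1 / 512 / 32) ^ k"
  \<comment> \<open>The constants are \<open>c = 1 / 512\<close>, \<open>C = 4\<close>,
    \<open>K = 128\<close> and \<open>\<kappa> = 1 / 4\<close>. \<open>M\<close> and
    \<open>Q\<close> are variables with defining equations, so that reflexivity matches them with
    the unfolded \<open>let\<close>.\<close>
  have main: "\<exists>A :: nat \<Rightarrow> int set.
            (\<forall>i\<in>{1..k}. real_of_int ` A i \<subseteq> {X i..2 * X i}) \<and>
            real (card {a \<in> PiE {1..k} A. real_of_int (Lcm (a ` {1..k})) \<le> L})
              \<ge> \<delta> * (\<Prod>i=1..k. real (card (A i))) \<and>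
            (\<Prod>i=1..k. real (card (A i)))
              \<ge> \<theta> * \<delta> powr (- real k / (real k - 1)) *
                (L powr (real k / (real k - 1)) /
                 (\<Prod>i=1..k. X i) powr (1 / (real k - 1)))"
    if \<delta>: "0 < \<delta>" "\<delta> \<le> 1" and X1: "\<And>i. i \<in> {1..k} \<Longrightarrow> 1 \<le> X i" and L: "1 \<le> L"
      and M_def: "M = real_of_int \<lceil>1 / 512 * \<delta> powr (- 1 / (real k - 1))\<rceil>"
      and Q_def: "Q = 4 * ((\<Prod>i=1..k. X i) / L) powr (1 / (real k - 1))"
      and KQ: "128 * M * ln (2 * M) \<le> Q" and Q_le: "Q \<le> 1 / 4 * Min (X ` {1..k})"
    for \<delta> L M Q :: real and X :: "nat \<Rightarrow> real"
  proof -
    define P where "P = (\<Prod>i=1..k. X i)"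
    define t where "t = \<delta> powr (- 1 / (real k - 1))"
    define m where "m = nat \<lceil>1 / 512 * t\<rceil>"
    have k1: "real (k - 1) = real k - 1" "real k - 1 > 0" using assms by auto
    have P: "P > 0" unfolding P_def using X1 by (intro prod_pos) force
    have t: "t > 0" unfolding t_def using \<delta> by simp
    have t_pow: "t ^ (k - 1) = 1 / \<delta>"
      unfolding t_def using \<delta> k1
      by (simp add: powr_powr powr_minus field_simps flip: powr_realpow)
    have t_pow': "t ^ k = \<delta> powr (- real k / (real k - 1))"
      unfolding t_def using \<delta> k1
      by (simp add: powr_powr flip: powr_realpow)
    have "\<lceil>1 / 512 * t\<rceil> > 0" using t by simp
    then have m: "m > 0" and M: "M = real m" by (simp_all add: m_def M_def t_def)
    have m_ge: "1 / 512 * t \<le> m" unfolding m_def by linarith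
    have Q: "Q > 0" unfolding Q_def P_def[symmetric] using P L by simp
    have Q_pow: "Q ^ (k - 1) = 4 ^ (k - 1) * P / L"
      unfolding Q_def P_def[symmetric] using P L k1
      by (simp add: powr_powr power_mult_distrib flip: powr_realpow)
    have X4: "4 * Q \<le> X i" if "i \<in> {1..k}" for i
    proof -
      have "Min (X ` {1..k}) \<le> X i" using that by (intro Min_le) auto
      then show ?thesis using Q_le by linarith
    qed
    define N where "N = \<lceil>Q\<rceil>"
    define D where "D = {N..<N + int m}"
    define A where "A i = (\<Union>q\<in>D. multiples (X i) q)" for i
    have N: "Q \<le> N" by (simp add: N_def)
    have KQ': "128 * real m * ln (2 * real m) \<le> Q" using KQ M by simp
    \<comment> \<open>Since \<open>128 * ln (2 * m)\<close> is at least \<open>1\<close>,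
      \<open>m\<close> is at most \<open>Q\<close>; this keeps all moduli between \<open>Q\<close>
      and \<open>2 * Q\<close>.\<close>
    have "real m * 1 \<le> real m * (128 * ln (2 * real m))"
      using ln_double_ge(2)[OF m] by (intro mult_left_mono) auto
    then have "m \<le> Q" using KQ' by (simp add: mult_ac)
    then have N2: "real_of_int N + m \<le> 2 * Q + 1" unfolding N_def by linarith
    have I: "finite {1..k}" "{1..k} \<noteq> {}" using assms by auto
    have A_lower: "m * (X i / (8 * Q)) \<le> card (A i)"
      and A_upper: "card (A i) \<le> m * (2 * X i / Q)" if "i \<in> {1..k}" for i
      unfolding A_def D_def using card_UN_multiples_bounds[OF m Q KQ' X4[OF that] N N2] by auto
    define G where "G = {a \<in> PiE {1..k} A. \<exists>q\<in>D. \<forall>i\<in>{1..k}. q dvd a i}"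
    have G_card: "m * (\<Prod>i=1..k. X i / (8 * Q)) \<le> card G"
      unfolding G_def A_def D_def
      using card_aligned_tuples_ge[OF m Q KQ' I X4 N N2] by simp
    have fin: "finite (PiE {1..k} A)" by (intro finite_PiE) (auto simp: A_def D_def)
    have A_range: "X i \<le> a" "a \<le> 2 * X i" if "a \<in> A i" for a i
      using that by (auto simp: A_def multiples_def)
    have lcm: "real_of_int (Lcm (a ` {1..k})) \<le> L" if "a \<in> G" for a
    proof -
      from that obtain q where q: "q \<in> D" and dvd: "\<And>i. i \<in> {1..k} \<Longrightarrow> q dvd a i"
        and a: "\<And>i. i \<in> {1..k} \<Longrightarrow> a i \<in> A i"
        unfolding G_def by (blast dest: PiE_mem)
      have "real_of_int N \<le> q" using q by (simp add: D_def)
      then have qQ: "Q \<le> q" using N by linarith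
      then have q0: "q > 0" using Q by linarith
      have "a i > 0" if "i \<in> {1..k}" for i using A_range(1)[OF a[OF that]] X1[OF that] by linarith
      then have "real_of_int (Lcm (a ` {1..k})) * real_of_int q ^ (k - 1) \<le> (\<Prod>i=1..k. 2 * X i)"
        using Lcm_common_divisor_le[OF I q0, of a "\<lambda>i. 2 * X i"] dvd A_range(2) a by simp
      also have "\<dots> = 2 ^ k * P" by (simp add: prod.distrib P_def)
      \<comment> \<open>Here \<open>k \<ge> 2\<close> gives \<open>k \<le> 2 * (k - 1)\<close>; the
        resulting \<open>4^(k-1)\<close> is exactly what the factor \<open>4\<close> in
        \<open>Q\<close> supplies.\<close>
      also have "\<dots> \<le> 2 ^ (2 * (k - 1)) * P" using assms P by (intro mult_right_mono power_increasing) auto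
      also have "\<dots> = L * Q ^ (k - 1)" using L Q_pow by (simp add: power_mult)
      also have "\<dots> \<le> L * real_of_int q ^ (k - 1)" using L qQ Q by (intro mult_left_mono power_mono) auto
      finally show ?thesis using q0 by simp
    qed
    have "card G \<le> card {a \<in> PiE {1..k} A. real_of_int (Lcm (a ` {1..k})) \<le> L}"
      using lcm fin by (intro card_mono) (auto simp: G_def)
    moreover have "\<delta> * (\<Prod>i=1..k. real (card (A i))) \<le> card G"
    \<comment> \<open>With a single modulus all tuples are aligned, so the proportion is
      \<open>1\<close>. The size bounds would lose \<open>16^k\<close>, too much for
      \<open>\<delta>\<close> near \<open>1\<close>.\<close>
    proof (cases "m = 1")
      case True
      then have D_eq: "D = {N}" by (auto simp: D_def)
      then have "N dvd a i" if "a \<in> PiE {1..k} A" "i \<in> {1..k}" for a i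
        using PiE_mem[OF that] by (simp add: A_def multiples_def)
      then have "G = PiE {1..k} A" unfolding G_def D_eq by blast
      then have "real (card G) = (\<Prod>i=1..k. real (card (A i)))" by (simp add: card_PiE)
      then show ?thesis using \<delta> by (auto intro!: mult_left_le_one_le prod_nonneg)
    next
      case False
      then have "1 < 1 / 512 * t" using m unfolding m_def by linarith
      \<comment> \<open>Rounding up a number above \<open>1\<close> at most doubles it. As
        \<open>256 = 16^2\<close> and \<open>2 * (k - 1) \<ge> k\<close>, the power
        \<open>k - 1\<close> then pays for the loss of \<open>16^k\<close>.\<close>
      then have "m \<le> 1 / 256 * t" unfolding m_def by linarith
      then have "real m ^ (k - 1) \<le> (1 / 256 * t) ^ (k - 1)" by (intro power_mono) auto
      also have "\<dots> = 1 / 16 ^ (2 * (k - 1)) / \<delta>"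
        unfolding power_mult_distrib t_pow by (simp add: power_divide power_mult)
      also have "\<dots> \<le> 1 / 16 ^ k / \<delta>"
        using assms \<delta> by (intro divide_right_mono divide_left_mono power_increasing) auto
      finally have ratio: "\<delta> * real m ^ (k - 1) * 16 ^ k \<le> 1" using \<delta> by (simp add: field_simps)
      have "(\<Prod>i=1..k. real (card (A i))) \<le> (\<Prod>i=1..k. m * (2 * X i / Q))"
        using A_upper by (intro prod_mono) auto
      also have "\<dots> = (\<Prod>i=1..k. (m * 16) * (X i / (8 * Q)))"
        by (intro prod.cong) auto
      also have "\<dots> = real m ^ k * 16 ^ k * (\<Prod>i=1..k. X i / (8 * Q))"
        by (simp only: prod.distrib power_mult_distrib) simp
      also have "real m ^ k = real m * real m ^ (k - 1)" using assms by (cases k) auto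
      finally have "\<delta> * (\<Prod>i=1..k. real (card (A i)))
          \<le> (\<delta> * real m ^ (k - 1) * 16 ^ k) * (m * (\<Prod>i=1..k. X i / (8 * Q)))"
        using \<delta> by (simp add: mult_ac)
      also have "\<dots> \<le> 1 * (m * (\<Prod>i=1..k. X i / (8 * Q)))"
        using ratio Q X4 by (intro mult_right_mono mult_nonneg_nonneg prod_nonneg) force+
      also have "\<dots> \<le> card G" using G_card by simp
      finally show ?thesis .
    qed
    moreover have "\<theta> * \<delta> powr (- real k / (real k - 1)) *
        (L powr (real k / (real k - 1)) / P powr (1 / (real k - 1))) \<le> (\<Prod>i=1..k. real (card (A i)))"
    proof -
      \<comment> \<open>This turns \<open>P / Q^k\<close>, with its power \<open>k / (k - 1)\<close>
        of \<open>P\<close> in the denominator, into the quotient of powers of \<open>L\<close> and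
        \<open>P\<close> in the claim.\<close>
      have "1 + 1 / (real k - 1) = real k / (real k - 1)" using k1 by (simp add: field_simps)
      then have "P powr (1 / (real k - 1)) * P = P powr (real k / (real k - 1))"
        using powr_mult_base[of P "1 / (real k - 1)"] P by (simp add: mult.commute)
      moreover have "Q ^ k = 4 ^ k * (P powr (real k / (real k - 1)) / L powr (real k / (real k - 1)))"
      proof -
        have "(x powr (1 / (real k - 1))) ^ k = x powr (real k / (real k - 1))" if "x > 0" for x :: real
          using that by (simp add: powr_powr flip: powr_realpow)
        then show ?thesis
          unfolding Q_def P_def[symmetric] power_mult_distrib using P L by (simp add: powr_divide power_divide)
      qed
      ultimately have P_Q: "P / Q ^ k = (1 / 4) ^ k * (L powr (real k / (real k - 1)) / P powr (1 / (real k - 1)))"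
        using P L Q by (simp add: field_simps)
      have P_8Q: "P / (8 * Q) ^ k = (1 / 8) ^ k * (P / Q ^ k)"
        by (simp add: power_mult_distrib power_divide)
      have "\<theta> = (1 / 512) ^ k * ((1 / 8) ^ k * (1 / 4) ^ k)"
        by (simp add: \<theta>_def flip: power_mult_distrib)
      then have "\<theta> * \<delta> powr (- real k / (real k - 1)) *
          (L powr (real k / (real k - 1)) / P powr (1 / (real k - 1))) = (1 / 512 * t) ^ k * (P / (8 * Q) ^ k)"
        unfolding P_8Q P_Q power_mult_distrib[of _ t] t_pow'[symmetric] by (simp only: mult_ac)
      also have "\<dots> \<le> real m ^ k * (P / (8 * Q) ^ k)"
        using m_ge t P Q by (intro mult_right_mono power_mono) auto
      also have "\<dots> = (\<Prod>i=1..k. m * (X i / (8 * Q)))"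
        by (simp add: prod.distrib prod_dividef P_def)
      also have "\<dots> \<le> (\<Prod>i=1..k. real (card (A i)))"
        using A_lower Q X4 by (intro prod_mono) force
      finally show ?thesis .
    qed
    moreover have "\<forall>i\<in>{1..k}. real_of_int ` A i \<subseteq> {X i..2 * X i}"
      using A_range by auto
    ultimately show ?thesis unfolding P_def by (intro exI[of _ A]) auto
  qed
  show ?thesis
    unfolding Let_def
  proof (rule exI[of _ "1 / 512"], rule exI[of _ 4], rule exI[of _ 128], rule exI[of _ "1 / 4"],
      rule exI[of _ \<theta>], intro conjI allI impI)
    show "0 < (1 / 512 :: real)" "0 < (4 :: real)" "0 < (128 :: real)" "0 < (1 / 4 :: real)" "0 < \<theta>"
      by (simp_all add: \<theta>_def)
  qed (elim conjE, rule main, (assumption | rule refl | erule bspec)+)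
qed

end
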